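(* Let $n$ be a positive integer. (1) The maximum $m$ such that the bipartite graph $B_{2m}$ has a biclique partition of thickness at most $n$ is equal to the maximum size of an $(n,n)$-bounded 1-cross intersecting set pair system. (2) The maximum $m$ such that the cocktail party graph $T_{2m}$ has a clique partition of thickness at most $n$ is equal to the maximum size of an $(n,n)$-bounded 1-cross intersecting set pair system $(\mathcal{A},\mathcal{B})$ in which $\mathcal{A}$ and $\mathcal{B}$ are also 1-intersecting.
   Context: A cross intersecting set pair system (SPS) of size $m\ge 2$ consists of finite sets $A_1,\dots,A_m$ and $B_1,\dots,B_m$ such that $A_i\cap B_i=\emptyset$ for every $1\le i\le m$ and $A_i\cap B_j\neq\emptyset$ for all $1\le i\neq j\le m$; one writes $\mathcal{A}=\{A_i\}_{i=1}^m$, $\mathcal{B}=\{B_i\}_{i=1}^m$. It is $(a,b)$-bounded if $|A_i|\le a$ and $|B_i|\le b$ for each $i$. It is 1-cross intersecting if $|A_i\cap B_j|=1$ for each $i\neq j$. $\mathcal{A}$ (resp. $\mathcal{B}$) is 1-intersecting if $|A_i\cap A_j|=1$ (resp. $|B_i\cap B_j|=1$) for all $i\ne j$. $T_{2m}$ is the cocktail party graph: the complete graph $K_{2m}$ from which a perfect matching is removed. $B_{2m}$ is the bipartite graph obtained from the complete bipartite graph $K_{m,m}$ by removing a perfect matching. A clique partition of a graph is a partition of its edge set into (edge sets of) complete graphs. A biclique partition of a bipartite graph is a partition of its edge set into (edge sets of) complete bipartite graphs (bicliques). The thickness of a clique (biclique) partition is the minimum $s$ such that every vertex of the graph is in at most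 $s$ of the cliques (bicliques) of the partition. All maxima are taken over integers $m\ge 2$; if no admissible $m\geq 2$ exists on one side of an equality, the equality is understood to mean that none exists on the other side. *)

theory Defs
  imports Main "HOL-Library.Disjoint_Sets"
begin

section \<open>Cross intersecting set pair systems\<close>

text \<open>The families are indexed by \<open>{1..m}\<close>; values outside this range are irrelevant.\<close>

definition cross_intersecting_sps ::
  "nat \<Rightarrow> (nat \<Rightarrow> 'a set) \<Rightarrow> (nat \<Rightarrow> 'a set) \<Rightarrow> bool" where
  "cross_intersecting_sps m A B \<longleftrightarrow>
     m \<ge> 2 \<and>
     (\<forall>i\<in>{1..m}. finite (A i) \<and> finite (B i)) \<and>
     (\<forall>i\<in>{1..m}. A i \<inter> B i = {}) \<and>
     (\<forall>i\<in>{1..m}. \<forall>j\<in>{1..m}. i \<noteq> j \<longrightarrow> A i \<inter> B j \<noteq> {})"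

definition bounded_sps ::
  "nat \<Rightarrow> nat \<Rightarrow> nat \<Rightarrow> (nat \<Rightarrow> 'a set) \<Rightarrow> (nat \<Rightarrow> 'a set) \<Rightarrow> bool" where
  "bounded_sps a b m A B \<longleftrightarrow> (\<forall>i\<in>{1..m}. card (A i) \<le> a \<and> card (B i) \<le> b)"

definition one_cross_intersecting ::
  "nat \<Rightarrow> (nat \<Rightarrow> 'a set) \<Rightarrow> (nat \<Rightarrow> 'a set) \<Rightarrow> bool" where
  "one_cross_intersecting m A B \<longleftrightarrow>
     (\<forall>i\<in>{1..m}. \<forall>j\<in>{1..m}. i \<noteq> j \<longrightarrow> card (A i \<inter> B j) = 1)"

definition one_intersecting :: "nat \<Rightarrow> (nat \<Rightarrow> 'a set) \<Rightarrow> bool" where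
  "one_intersecting m A \<longleftrightarrow>
     (\<forall>i\<in>{1..m}. \<forall>j\<in>{1..m}. i \<noteq> j \<longrightarrow> card (A i \<inter> A j) = 1)"


section \<open>Clique and biclique partitions\<close>

text \<open>A simple graph is given by a vertex set \<open>V\<close> and a set \<open>E\<close> of two-element subsets of \<open>V\<close>.\<close>

definition complete_edges :: "'v set \<Rightarrow> 'v set set" where
  "complete_edges W = {{u, v} | u v. u \<in> W \<and> v \<in> W \<and> u \<noteq> v}"

text \<open>The next definition is meant for disjoint \<open>X\<close> and \<open>Y\<close>.\<close>

definition complete_bipartite_edges :: "'v set \<Rightarrow> 'v set \<Rightarrow> 'v set set" where
  "complete_bipartite_edges X Y = {{x, y} | x y. x \<in> X \<and> y \<in> Y}"

text \<open>
  The members of a partition are edge sets. By \<^const>\<open>partition_on\<close> they are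
  nonempty, so the vertex set of the corresponding (bi)clique is the union of its edges.
\<close>

definition clique_partition :: "'v set \<Rightarrow> 'v set set \<Rightarrow> 'v set set set \<Rightarrow> bool" where
  "clique_partition V E P \<longleftrightarrow>
     partition_on E P \<and> (\<forall>C\<in>P. \<exists>W\<subseteq>V. C = complete_edges W)"

definition biclique_partition :: "'v set \<Rightarrow> 'v set set \<Rightarrow> 'v set set set \<Rightarrow> bool" where
  "biclique_partition V E P \<longleftrightarrow>
     partition_on E P \<and>
     (\<forall>C\<in>P. \<exists>X\<subseteq>V. \<exists>Y\<subseteq>V. X \<inter> Y = {} \<and> C = complete_bipartite_edges X Y)"

definition thickness :: "'v set \<Rightarrow> 'v set set set \<Rightarrow> nat" where
  "thickness V P = (LEAST s. \<forall>v\<in>V. card {C \<in> P. v \<in> \<Union>C} \<le> s)"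


section \<open>The two graphs\<close>

text \<open>
  Both graphs live on the same \<open>2m\<close> vertices, and the perfect matching removed is
  the one joining \<open>Inl i\<close> to \<open>Inr i\<close>.
\<close>

definition left_vertices :: "nat \<Rightarrow> (nat + nat) set" where
  "left_vertices m = Inl ` {1..m}"

definition right_vertices :: "nat \<Rightarrow> (nat + nat) set" where
  "right_vertices m = Inr ` {1..m}"

definition all_vertices :: "nat \<Rightarrow> (nat + nat) set" where
  "all_vertices m = left_vertices m \<union> right_vertices m"

definition matching_edges :: "nat \<Rightarrow> (nat + nat) set set" where
  "matching_edges m = {{Inl i, Inr i} | i. i \<in> {1..m}}"

definition cocktail_party_edges :: "nat \<Rightarrow> (nat + nat) set set" where
  "cocktail_party_edges m = complete_edges (all_vertices m) - matching_edges m"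

definition bipartite_minus_matching_edges :: "nat \<Rightarrow> (nat + nat) set set" where
  "bipartite_minus_matching_edges m =
     complete_bipartite_edges (left_vertices m) (right_vertices m) - matching_edges m"


section \<open>The sets of admissible sizes\<close>

definition biclique_sizes :: "nat \<Rightarrow> nat set" where
  "biclique_sizes n = {m. m \<ge> 2 \<and>
     (\<exists>P. biclique_partition (all_vertices m) (bipartite_minus_matching_edges m) P \<and>
          thickness (all_vertices m) P \<le> n)}"

definition clique_sizes :: "nat \<Rightarrow> nat set" where
  "clique_sizes n = {m. m \<ge> 2 \<and>
     (\<exists>P. clique_partition (all_vertices m) (cocktail_party_edges m) P \<and>
          thickness (all_vertices m) P \<le> n)}"

text \<open>
  An SPS consists of finitely many finite sets, so after renaming its elements
  its ground set may be taken inside the natural numbers.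
\<close>

definition one_cross_sps_sizes :: "nat \<Rightarrow> nat set" where
  "one_cross_sps_sizes n = {m. \<exists>A B :: nat \<Rightarrow> nat set.
     cross_intersecting_sps m A B \<and> bounded_sps n n m A B \<and> one_cross_intersecting m A B}"

definition one_cross_one_intersecting_sps_sizes :: "nat \<Rightarrow> nat set" where
  "one_cross_one_intersecting_sps_sizes n = {m. \<exists>A B :: nat \<Rightarrow> nat set.
     cross_intersecting_sps m A B \<and> bounded_sps n n m A B \<and> one_cross_intersecting m A B \<and>
     one_intersecting m A \<and> one_intersecting m B}"

text \<open>
  Equality of maxima, including that both maxima exist unless both sets are empty
  (\<^const>\<open>Max\<close> is only meaningful on finite nonempty sets).
\<close>

definition same_maximum :: "nat set \<Rightarrow> nat set \<Rightarrow> bool" where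
  "same_maximum S T \<longleftrightarrow>
     finite S \<and> finite T \<and> (S = {} \<longleftrightarrow> T = {}) \<and> (S \<noteq> {} \<longrightarrow> Max S = Max T)"

end

theory Submission
  imports Defs
begin

text \<open>
  For each of the two graphs the two sets of admissible sizes are in fact equal, and they are
  finite; this is stronger than having the same maximum.

  The equality is a duality between partitions and set systems. Given a partition \<open>P\<close> of the
  edges into (bi)cliques, send a vertex \<open>v\<close> to the set of members of \<open>P\<close> that contain \<open>v\<close>. Given
  sets \<open>S v\<close> attached to the vertices, send an element \<open>x\<close> of the ground set to the (bi)clique on
  the vertices \<open>v\<close> with \<open>x \<in> S v\<close>. Then \<open>A\<^sub>i\<close> is the set at the left vertex \<open>i\<close> and \<open>B\<^sub>i\<close> the one at
  the right vertex \<open>i\<close>. That every edge lies in exactly one member of \<open>P\<close> says that the sets of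
  adjacent vertices share exactly one element; that no removed edge is covered says that
  \<open>A\<^sub>i \<inter> B\<^sub>i = {}\<close>; and a bound on the thickness is a bound on the sizes of the sets.

  Cliques and bicliques are treated at once by fixing an ambient graph \<open>K\<close>, namely the complete or
  the complete bipartite graph on the \<open>2m\<close> vertices: the members of the partition are then
  precisely the subgraphs of \<open>K\<close> induced by vertex sets. The duality for arbitrary \<open>K\<close> is
  \<open>induced_partition_iff_intersection_representation\<close>.

  Finiteness is a weak form of Bollobas's set pair inequality, \<open>cross_intersecting_card_le\<close>.
\<close>

section \<open>Finiteness of cross intersecting set pair systems\<close>

text \<open>
  Fix one index \<open>k\<close>. Each other \<open>B i\<close> meets \<open>A k\<close>, so the other indices are covered by at most \<open>a\<close>
  classes, one for each \<open>x \<in> A k\<close>, consisting of the \<open>i\<close> with \<open>x \<in> B i\<close>. Within such a class \<open>x\<close>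
  lies in no \<open>A i\<close>, so deleting it from every \<open>B i\<close> keeps the system cross intersecting and
  lowers \<open>b\<close> by one.
\<close>

lemma cross_intersecting_card_le:
  fixes A B :: "'i \<Rightarrow> 'a set"
  assumes "finite I"
    and "\<And>i. i \<in> I \<Longrightarrow> finite (A i) \<and> card (A i) \<le> a"
    and "\<And>i. i \<in> I \<Longrightarrow> finite (B i) \<and> card (B i) \<le> b"
    and "\<And>i. i \<in> I \<Longrightarrow> A i \<inter> B i = {}"
    and "\<And>i j. i \<in> I \<Longrightarrow> j \<in> I \<Longrightarrow> i \<noteq> j \<Longrightarrow> A i \<inter> B j \<noteq> {}"
  shows "card I \<le> (a + 1) ^ b"
  using assms
proof (induction b arbitrary: I B)
  case 0
  have "B i = {}" if "i \<in> I" for i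
    using "0.prems"(3)[OF that] by auto
  then have "i = j" if "i \<in> I" "j \<in> I" for i j
    using "0.prems"(5)[OF that] that by auto
  then have "card I \<le> Suc 0"
    using card_le_Suc0_iff_eq[OF \<open>finite I\<close>] by blast
  then show ?case by simp
next
  case (Suc b)
  show ?case
  proof (cases "I = {}")
    case False
    then obtain k where k: "k \<in> I" by blast
    define J where "J x = {i \<in> I. x \<in> B i}" for x
    have J_le: "card (J x) \<le> (a + 1) ^ b" for x
    proof (rule Suc.IH[of "J x" "\<lambda>i. B i - {x}"])
      show "finite (J x)"
        using Suc.prems(1) by (simp add: J_def)
      show "finite (A i) \<and> card (A i) \<le> a" if "i \<in> J x" for i
        using Suc.prems(2) that by (simp add: J_def)
      show "finite (B i - {x}) \<and> card (B i - {x}) \<le> b" if "i \<in> J x" for i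
        using Suc.prems(3)[of i] that by (auto simp: J_def)
      show "A i \<inter> (B i - {x}) = {}" if "i \<in> J x" for i
        using Suc.prems(4)[of i] that by (auto simp: J_def)
      show "A i \<inter> (B j - {x}) \<noteq> {}" if "i \<in> J x" "j \<in> J x" "i \<noteq> j" for i j
        using Suc.prems(4)[of i] Suc.prems(5)[of i j] that by (auto simp: J_def)
    qed
    have "I \<subseteq> insert k (\<Union>x\<in>A k. J x)"
      using Suc.prems(5)[OF k] by (fastforce simp: J_def)
    then have "card I \<le> card (insert k (\<Union>x\<in>A k. J x))"
      using Suc.prems(1,2) k by (intro card_mono) (auto simp: J_def)
    also have "\<dots> \<le> 1 + card (\<Union>x\<in>A k. J x)"
      by (simp add: card_insert_le_m1)
    also have "card (\<Union>x\<in>A k. J x) \<le> (\<Sum>x\<in>A k. card (J x))"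
      using Suc.prems(2)[OF k] by (intro card_UN_le) simp
    also have "\<dots> \<le> card (A k) * (a + 1) ^ b"
      using sum_bounded_above[of "A k" "\<lambda>x. card (J x)", OF J_le] by simp
    also have "\<dots> \<le> a * (a + 1) ^ b"
      using Suc.prems(2)[OF k] by simp
    also have "1 + a * (a + 1) ^ b \<le> (a + 1) ^ Suc b"
      by simp
    finally show ?thesis by simp
  qed simp
qed

lemma finite_one_cross_sps_sizes: "finite (one_cross_sps_sizes n)"
proof (rule finite_subset)
  show "one_cross_sps_sizes n \<subseteq> {..(n + 1) ^ n}"
  proof
    fix m assume "m \<in> one_cross_sps_sizes n"
    then obtain A B :: "nat \<Rightarrow> nat set"
      where "cross_intersecting_sps m A B" "bounded_sps n n m A B"
      unfolding one_cross_sps_sizes_def by blast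
    then have "card {1..m} \<le> (n + 1) ^ n"
      by (intro cross_intersecting_card_le[of _ A n B])
         (auto simp: cross_intersecting_sps_def bounded_sps_def)
    then show "m \<in> {..(n + 1) ^ n}" by simp
  qed
qed simp

section \<open>Partitions into induced subgraphs and intersection representations\<close>

definition induced_edges :: "'v set set \<Rightarrow> 'v set \<Rightarrow> 'v set set" where
  "induced_edges K W = {e \<in> K. e \<subseteq> W}"

definition induced_partition ::
  "'v set \<Rightarrow> 'v set set \<Rightarrow> 'v set set \<Rightarrow> 'v set set set \<Rightarrow> bool" where
  "induced_partition V K E P \<longleftrightarrow>
     partition_on E P \<and> (\<forall>C\<in>P. \<exists>W\<subseteq>V. C = induced_edges K W)"

text \<open>
  Only pairs that are edges of \<open>K\<close> are constrained. For bipartite \<open>K\<close>, two sets on the same side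
  may meet in any way, which is what the mere 1-cross intersecting property allows.
\<close>

definition intersection_representation ::
  "nat \<Rightarrow> 'v set \<Rightarrow> 'v set set \<Rightarrow> 'v set set \<Rightarrow> ('v \<Rightarrow> 'a set) \<Rightarrow> bool" where
  "intersection_representation n V K E S \<longleftrightarrow>
     (\<forall>v\<in>V. finite (S v) \<and> card (S v) \<le> n) \<and>
     (\<forall>u v. {u, v} \<in> K \<longrightarrow> card (S u \<inter> S v) = (if {u, v} \<in> E then 1 else 0))"

lemma thickness_le_iff:
  assumes "finite V"
  shows "thickness V P \<le> n \<longleftrightarrow> (\<forall>v\<in>V. card {C \<in> P. v \<in> \<Union>C} \<le> n)"
proof
  let ?bound = "\<lambda>s. \<forall>v\<in>V. card {C \<in> P. v \<in> \<Union>C} \<le> s"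
  have "?bound (Max ((\<lambda>v. card {C \<in> P. v \<in> \<Union>C}) ` V))"
    using assms by simp
  then have "?bound (thickness V P)"
    unfolding thickness_def by (rule LeastI)
  then show "thickness V P \<le> n \<Longrightarrow> ?bound n"
    using order_trans by blast
  show "?bound n \<Longrightarrow> thickness V P \<le> n"
    unfolding thickness_def by (rule Least_le)
qed

text \<open>
  Since a member \<open>C\<close> of the partition is induced, it contains the edge \<open>{u, v}\<close> of \<open>K\<close> as soon as it
  covers both end points. Hence the members common to \<open>u\<close> and \<open>v\<close> are those containing \<open>{u, v}\<close>:
  one of them for an edge of \<open>E\<close>, none for another edge of \<open>K\<close>.
\<close>

lemma intersection_representation_of_induced_partition:
  fixes V :: "'v set"
  assumes "finite V" "K \<subseteq> Pow V" "E \<subseteq> K"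
    and P: "induced_partition V K E P" and thick: "thickness V P \<le> n"
  shows "\<exists>S :: 'v \<Rightarrow> nat set. intersection_representation n V K E S"
proof -
  have part: "partition_on E P" and ind: "\<And>C. C \<in> P \<Longrightarrow> \<exists>W. C = induced_edges K W"
    using P by (auto simp: induced_partition_def)
  have "finite E"
    using assms(1-3) by (meson finite_Pow_iff finite_subset)
  then have "finite P"
    using part by (rule finite_elements)
  \<comment> \<open>The members of the partition are renamed to natural numbers.\<close>
  then obtain code :: "'v set set \<Rightarrow> nat" where code: "inj_on code P"
    using finite_imp_inj_to_nat_seg by metis
  define star where "star v = {C \<in> P. v \<in> \<Union>C}" for v
  have star_sub: "star v \<subseteq> P" and star_fin: "finite (star v)" for v
    using \<open>finite P\<close> by (auto simp: star_def)
  have star_inter: "star u \<inter> star v = {C \<in> P. {u, v} \<in> C}" if "{u, v} \<in> K" for u v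
  proof -
    have "{u, v} \<in> C" if "C \<in> P" "u \<in> \<Union>C" "v \<in> \<Union>C" for C
      using ind[OF that(1)] that(2,3) \<open>{u, v} \<in> K\<close> by (auto simp: induced_edges_def)
    then show ?thesis by (auto simp: star_def)
  qed
  have "card (star u \<inter> star v) = (if {u, v} \<in> E then 1 else 0)" if uv: "{u, v} \<in> K" for u v
  proof (cases "{u, v} \<in> E")
    case True
    then obtain C where C: "C \<in> P" "{u, v} \<in> C"
      using partition_onD1[OF part] by blast
    then have "{D \<in> P. {u, v} \<in> D} = {C}"
      using partition_onD2[OF part] by (auto dest: disjointD)
    then show ?thesis
      using True star_inter[OF uv] by simp
  next
    case False
    then have "star u \<inter> star v = {}"
      using star_inter[OF uv] partition_onD1[OF part] by blast
    then show ?thesis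
      using False by simp
  qed
  moreover have "card (code ` star u \<inter> code ` star v) = card (star u \<inter> star v)" for u v
    using inj_on_image_Int[OF code star_sub star_sub] inj_on_subset[OF code] star_sub
    by (metis card_image inf.coboundedI1)
  moreover have "card (code ` star v) \<le> n" if "v \<in> V" for v
    using thick that star_fin card_image_le[of "star v" code]
    by (fastforce simp: thickness_le_iff[OF \<open>finite V\<close>] star_def)
  ultimately have "intersection_representation n V K E (\<lambda>v. code ` star v)"
    using star_fin by (auto simp: intersection_representation_def)
  then show ?thesis by blast
qed

text \<open>
  Each element \<open>x\<close> of the ground set gives the subgraph of \<open>K\<close> induced by the vertices whose set
  contains \<open>x\<close>. An edge \<open>{u, v}\<close> lies in exactly those given by \<open>x \<in> S u \<inter> S v\<close>.
\<close>

lemma induced_partition_of_intersection_representation: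
  fixes S :: "'v \<Rightarrow> 'a set"
  assumes "finite V" "\<And>e. e \<in> K \<Longrightarrow> \<exists>u\<in>V. \<exists>v\<in>V. e = {u, v}" "E \<subseteq> K"
    and S: "intersection_representation n V K E S"
  shows "\<exists>P. induced_partition V K E P \<and> thickness V P \<le> n"
proof -
  define cell where "cell x = induced_edges K {v \<in> V. x \<in> S v}" for x
  have mem_cell: "{u, v} \<in> cell x \<longleftrightarrow> x \<in> S u \<inter> S v"
    if "{u, v} \<in> K" "u \<in> V" "v \<in> V" for u v x
    using that by (auto simp: cell_def induced_edges_def)
  have fin: "finite (S v)" and le: "card (S v) \<le> n" if "v \<in> V" for v
    using S that by (auto simp: intersection_representation_def)
  \<comment> \<open>Elements that lie in fewer than two sets induce no edge; they are dropped.\<close>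
  define P where "P = range cell - {{}}"
  have "partition_on E P"
  proof (rule partition_onI)
    show "\<Union>P = E"
    proof (intro equalityI subsetI)
      fix e assume "e \<in> \<Union>P"
      then obtain x where x: "e \<in> cell x" by (auto simp: P_def)
      then have "e \<in> K" by (simp add: cell_def induced_edges_def)
      then obtain u v where uv: "u \<in> V" "v \<in> V" "e = {u, v}"
        using assms(2) by blast
      then have "x \<in> S u \<inter> S v"
        using mem_cell \<open>e \<in> K\<close> x by blast
      then have "card (S u \<inter> S v) \<noteq> 0"
        using fin uv by auto
      then show "e \<in> E"
        using S \<open>e \<in> K\<close> uv by (metis intersection_representation_def)
    next
      fix e assume "e \<in> E"
      then have "e \<in> K" using assms(3) by blast
      then obtain u v where uv: "u \<in> V" "v \<in> V" "e = {u, v}"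
        using assms(2) by blast
      then have "card (S u \<inter> S v) = 1"
        using S \<open>e \<in> E\<close> \<open>e \<in> K\<close> by (simp add: intersection_representation_def)
      then obtain x where "x \<in> S u \<inter> S v"
        by (metis card_1_singletonE insertI1)
      then have "e \<in> cell x"
        using mem_cell \<open>e \<in> K\<close> uv by blast
      then show "e \<in> \<Union>P" by (auto simp: P_def)
    qed
    show "disjnt C D" if CD: "C \<in> P" "D \<in> P" "C \<noteq> D" for C D
    proof (rule ccontr)
      obtain x y where xy: "C = cell x" "D = cell y"
        using CD(1,2) unfolding P_def by blast
      assume "\<not> disjnt C D"
      then obtain e where e: "e \<in> cell x" "e \<in> cell y"
        using xy by (auto simp: disjnt_iff)
      then have "e \<in> K" by (simp add: cell_def induced_edges_def)
      then obtain u v where uv: "u \<in> V" "v \<in> V" "e = {u, v}"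
        using assms(2) by blast
      have both: "x \<in> S u \<inter> S v" "y \<in> S u \<inter> S v"
        using mem_cell \<open>e \<in> K\<close> uv e by blast+
      have "card (S u \<inter> S v) \<le> Suc 0"
        using S \<open>e \<in> K\<close> uv by (simp add: intersection_representation_def)
      moreover have "finite (S u \<inter> S v)" using fin uv by blast
      ultimately have "x = y"
        using both by (metis card_le_Suc0_iff_eq)
      then show False using xy CD(3) by simp
    qed
    show "{} \<notin> P"
      by (simp add: P_def)
  qed
  moreover have "\<exists>W\<subseteq>V. C = induced_edges K W" if C: "C \<in> P" for C
  proof -
    obtain x where "C = cell x"
      using C unfolding P_def by blast
    then show ?thesis
      unfolding cell_def by (intro exI[of _ "{v \<in> V. x \<in> S v}"]) simp
  qed
  moreover have "thickness V P \<le> n"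
    unfolding thickness_le_iff[OF \<open>finite V\<close>]
  proof
    fix v assume v: "v \<in> V"
    have "{C \<in> P. v \<in> \<Union>C} \<subseteq> cell ` S v"
      by (auto simp: P_def cell_def induced_edges_def)
    then have "card {C \<in> P. v \<in> \<Union>C} \<le> card (S v)"
      using fin[OF v] by (rule surj_card_le[rotated])
    then show "card {C \<in> P. v \<in> \<Union>C} \<le> n"
      using le[OF v] by (rule order_trans)
  qed
  ultimately show ?thesis
    by (auto simp: induced_partition_def)
qed

theorem induced_partition_iff_intersection_representation:
  fixes V :: "'v set"
  assumes "finite V" "\<And>e. e \<in> K \<Longrightarrow> \<exists>u\<in>V. \<exists>v\<in>V. e = {u, v}" "E \<subseteq> K"
  shows "(\<exists>P. induced_partition V K E P \<and> thickness V P \<le> n) \<longleftrightarrow>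
         (\<exists>S :: 'v \<Rightarrow> nat set. intersection_representation n V K E S)"
proof -
  have "K \<subseteq> Pow V" using assms(2) by fast
  then show ?thesis
    using intersection_representation_of_induced_partition[OF assms(1) _ assms(3)]
      induced_partition_of_intersection_representation[OF assms] by blast
qed

section \<open>Cliques and bicliques as induced subgraphs\<close>

lemma clique_partition_iff_induced_partition:
  "clique_partition V E P \<longleftrightarrow> induced_partition V (complete_edges V) E P"
proof -
  have "complete_edges W = induced_edges (complete_edges V) W" if "W \<subseteq> V" for W
    using that by (fastforce simp: complete_edges_def induced_edges_def)
  then show ?thesis
    unfolding clique_partition_def induced_partition_def by metis
qed

lemma doubleton_mem_complete_bipartite_edges_iff:
  "{u, v} \<in> complete_bipartite_edges X Y \<longleftrightarrow> u \<in> X \<and> v \<in> Y \<or> v \<in> X \<and> u \<in> Y"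
  by (auto simp: complete_bipartite_edges_def doubleton_eq_iff)

lemma complete_bipartite_edges_commute:
  "complete_bipartite_edges X Y = complete_bipartite_edges Y X"
  unfolding complete_bipartite_edges_def by (metis insert_commute)

lemma complete_bipartite_edges_eq_induced:
  assumes "L \<inter> R = {}" "X \<subseteq> L" "Y \<subseteq> R"
  shows "complete_bipartite_edges X Y = induced_edges (complete_bipartite_edges L R) (X \<union> Y)"
proof (intro equalityI subsetI)
  fix e assume "e \<in> complete_bipartite_edges X Y"
  then obtain x y where "e = {x, y}" "x \<in> X" "y \<in> Y"
    by (auto simp: complete_bipartite_edges_def)
  then show "e \<in> induced_edges (complete_bipartite_edges L R) (X \<union> Y)"
    using assms(2,3)
    by (auto simp: induced_edges_def doubleton_mem_complete_bipartite_edges_iff)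
next
  fix e assume e: "e \<in> induced_edges (complete_bipartite_edges L R) (X \<union> Y)"
  then obtain u v where uv: "e = {u, v}" "u \<in> L" "v \<in> R"
    by (auto simp: induced_edges_def complete_bipartite_edges_def)
  then have "u \<in> X" "v \<in> Y"
    using assms e by (auto simp: induced_edges_def)
  then show "e \<in> complete_bipartite_edges X Y"
    using uv by (simp add: doubleton_mem_complete_bipartite_edges_iff)
qed

text \<open>
  The two sides of a biclique need not be given as a left and a right part, but this can be
  arranged: a vertex on one side that is left forces the whole other side to be right, and
  conversely, because every edge crosses from \<open>L\<close> to \<open>R\<close>.
\<close>

lemma biclique_sides:
  assumes LR: "L \<inter> R = {}" and XY: "X \<subseteq> L \<union> R" "Y \<subseteq> L \<union> R"
    and sub: "complete_bipartite_edges X Y \<subseteq> complete_bipartite_edges L R"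
    and ne: "complete_bipartite_edges X Y \<noteq> {}"
  shows "X \<subseteq> L \<and> Y \<subseteq> R \<or> X \<subseteq> R \<and> Y \<subseteq> L"
proof -
  have cross: "x \<in> L \<and> y \<in> R \<or> x \<in> R \<and> y \<in> L" if "x \<in> X" "y \<in> Y" for x y
  proof -
    have "{x, y} \<in> complete_bipartite_edges X Y"
      using that by (simp add: doubleton_mem_complete_bipartite_edges_iff)
    then have "{x, y} \<in> complete_bipartite_edges L R" using sub by blast
    then show ?thesis by (auto simp: doubleton_mem_complete_bipartite_edges_iff)
  qed
  obtain x y where "x \<in> X" "y \<in> Y"
    using ne by (auto simp: complete_bipartite_edges_def)
  with cross LR show ?thesis by blast
qed

lemma biclique_partition_iff_induced_partition:
  assumes LR: "L \<inter> R = {}" and E: "E \<subseteq> complete_bipartite_edges L R"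
  shows "biclique_partition (L \<union> R) E P \<longleftrightarrow>
         induced_partition (L \<union> R) (complete_bipartite_edges L R) E P"
proof -
  let ?K = "complete_bipartite_edges L R"
  have members: "(\<exists>X\<subseteq>L \<union> R. \<exists>Y\<subseteq>L \<union> R. X \<inter> Y = {} \<and> C = complete_bipartite_edges X Y) \<longleftrightarrow>
        (\<exists>W\<subseteq>L \<union> R. C = induced_edges ?K W)" (is "?biclique \<longleftrightarrow> ?induced")
    if part: "partition_on E P" and C: "C \<in> P" for C
  proof
    have "C \<noteq> {}" using partition_onD3[OF part] C by blast
    moreover have "C \<subseteq> ?K" using partition_onD1[OF part] C E by blast
    moreover assume ?biclique
    then obtain X Y where XY: "X \<subseteq> L \<union> R" "Y \<subseteq> L \<union> R" "C = complete_bipartite_edges X Y"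
      by blast
    ultimately have "X \<subseteq> L \<and> Y \<subseteq> R \<or> X \<subseteq> R \<and> Y \<subseteq> L"
      using biclique_sides[OF LR] by simp
    then have "C = induced_edges ?K (X \<union> Y)"
      using complete_bipartite_edges_eq_induced[OF LR] XY(3)
      by (metis complete_bipartite_edges_commute sup_commute)
    then show ?induced using XY by blast
  next
    assume ?induced
    then obtain W where W: "W \<subseteq> L \<union> R" "C = induced_edges ?K W" by blast
    then have "C = complete_bipartite_edges (W \<inter> L) (W \<inter> R)"
      using complete_bipartite_edges_eq_induced[OF LR, of "W \<inter> L" "W \<inter> R"]
      by (simp add: Int_Un_distrib[symmetric] inf_absorb1)
    moreover have "W \<inter> L \<subseteq> L \<union> R" "W \<inter> R \<subseteq> L \<union> R" "(W \<inter> L) \<inter> (W \<inter> R) = {}"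
      using LR by blast+
    ultimately show ?biclique by metis
  qed
  show ?thesis
    unfolding biclique_partition_def induced_partition_def
    by (intro conj_cong refl ball_cong) (rule members)
qed

section \<open>The sets of admissible sizes coincide\<close>

lemma finite_all_vertices: "finite (all_vertices m)"
  by (simp add: all_vertices_def left_vertices_def right_vertices_def)

lemma doubleton_mem_matching_edges_iff:
  "{Inl i, Inr j} \<in> matching_edges m \<longleftrightarrow> i = j \<and> i \<in> {1..m}"
  "{Inl i, Inl j} \<notin> matching_edges m"
  "{Inr i, Inr j} \<notin> matching_edges m"
  by (auto simp: matching_edges_def doubleton_eq_iff)

text \<open>
  \<open>A i \<inter> B i\<close> is the case of a pair of vertices adjacent in \<open>K\<close> but not in \<open>E\<close>; all other pairs of
  a left and a right vertex are adjacent in both.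
\<close>

lemma one_cross_intersecting_sps_iff:
  assumes "m \<ge> 2"
  shows "cross_intersecting_sps m A B \<and> bounded_sps n n m A B \<and> one_cross_intersecting m A B \<longleftrightarrow>
         (\<forall>i\<in>{1..m}. finite (A i) \<and> card (A i) \<le> n \<and> finite (B i) \<and> card (B i) \<le> n) \<and>
         (\<forall>i\<in>{1..m}. \<forall>j\<in>{1..m}. card (A i \<inter> B j) = (if i = j then 0 else 1))"
    (is "?sps \<longleftrightarrow> ?fin \<and> ?cards")
proof (intro iffI conjI)
  assume sps: ?sps
  then show ?fin
    by (auto simp: cross_intersecting_sps_def bounded_sps_def)
  show ?cards
    using sps by (simp add: cross_intersecting_sps_def one_cross_intersecting_def)
next
  assume "?fin \<and> ?cards"
  then have fin: ?fin and cards: ?cards by blast+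
  have "A i \<inter> B i = {}" if "i \<in> {1..m}" for i
    using fin cards that by (metis card_0_eq finite_Int)
  moreover have "A i \<inter> B j \<noteq> {}" if "i \<in> {1..m}" "j \<in> {1..m}" "i \<noteq> j" for i j
    using cards that by (metis card.empty zero_neq_one)
  ultimately show "cross_intersecting_sps m A B"
    using fin assms by (simp add: cross_intersecting_sps_def)
  show "bounded_sps n n m A B"
    using fin by (simp add: bounded_sps_def)
  show "one_cross_intersecting m A B"
    using cards by (simp add: one_cross_intersecting_def)
qed

lemma intersection_representation_bipartite_iff:
  fixes A B :: "nat \<Rightarrow> 'a set"
  assumes "m \<ge> 2"
  shows "intersection_representation n (all_vertices m)
           (complete_bipartite_edges (left_vertices m) (right_vertices m))
           (bipartite_minus_matching_edges m) (case_sum A B) \<longleftrightarrow>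
         cross_intersecting_sps m A B \<and> bounded_sps n n m A B \<and> one_cross_intersecting m A B"
proof -
  let ?K = "complete_bipartite_edges (left_vertices m) (right_vertices m)"
  let ?E = "bipartite_minus_matching_edges m"
  define good where
    "good u v \<longleftrightarrow> card (case_sum A B u \<inter> case_sum A B v) = (if {u, v} \<in> ?E then 1 else 0)" for u v
  have good_sym: "good (Inr j) (Inl i) \<longleftrightarrow> good (Inl i) (Inr j)" for i j
    by (simp add: good_def Int_commute insert_commute)
  have good_iff: "good (Inl i) (Inr j) \<longleftrightarrow> card (A i \<inter> B j) = (if i = j then 0 else 1)"
    if "i \<in> {1..m}" "j \<in> {1..m}" for i j
    using that
    by (simp add: good_def bipartite_minus_matching_edges_def doubleton_mem_matching_edges_iff
        doubleton_mem_complete_bipartite_edges_iff left_vertices_def right_vertices_def)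
  have "(\<forall>u v. {u, v} \<in> ?K \<longrightarrow> good u v) \<longleftrightarrow> (\<forall>i\<in>{1..m}. \<forall>j\<in>{1..m}. good (Inl i) (Inr j))"
    unfolding doubleton_mem_complete_bipartite_edges_iff left_vertices_def right_vertices_def
    by (auto simp: good_sym)
  moreover have "(\<forall>v\<in>all_vertices m. finite (case_sum A B v) \<and> card (case_sum A B v) \<le> n) \<longleftrightarrow>
      (\<forall>i\<in>{1..m}. finite (A i) \<and> card (A i) \<le> n \<and> finite (B i) \<and> card (B i) \<le> n)"
    unfolding all_vertices_def left_vertices_def right_vertices_def by (auto simp: ball_Un)
  ultimately show ?thesis
    unfolding one_cross_intersecting_sps_iff[OF assms] intersection_representation_def
      good_def[symmetric]
    by (simp add: good_iff)
qed

lemma intersection_representation_complete_iff: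
  fixes A B :: "nat \<Rightarrow> 'a set"
  assumes "m \<ge> 2"
  shows "intersection_representation n (all_vertices m)
           (complete_edges (all_vertices m)) (cocktail_party_edges m) (case_sum A B) \<longleftrightarrow>
         (cross_intersecting_sps m A B \<and> bounded_sps n n m A B \<and> one_cross_intersecting m A B) \<and>
         one_intersecting m A \<and> one_intersecting m B"
proof -
  let ?K = "complete_edges (all_vertices m)"
  let ?E = "cocktail_party_edges m"
  define good where
    "good u v \<longleftrightarrow> card (case_sum A B u \<inter> case_sum A B v) = (if {u, v} \<in> ?E then 1 else 0)" for u v
  have K: "{u, v} \<in> ?K \<longleftrightarrow> u \<in> all_vertices m \<and> v \<in> all_vertices m \<and> u \<noteq> v" for u v
    by (auto simp: complete_edges_def doubleton_eq_iff)
  have good_sym: "good (Inr j) (Inl i) \<longleftrightarrow> good (Inl i) (Inr j)" for i j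
    by (simp add: good_def Int_commute insert_commute)
  have vertex: "Inl i \<in> all_vertices m" "Inr i \<in> all_vertices m" if "i \<in> {1..m}" for i
    using that by (simp_all add: all_vertices_def left_vertices_def right_vertices_def)
  have good_iff: "good (Inl i) (Inr j) \<longleftrightarrow> card (A i \<inter> B j) = (if i = j then 0 else 1)"
    if "i \<in> {1..m}" "j \<in> {1..m}" for i j
    using that vertex
    by (simp add: good_def cocktail_party_edges_def doubleton_mem_matching_edges_iff K)
  have good_same: "good (Inl i) (Inl j) \<longleftrightarrow> card (A i \<inter> A j) = 1"
      "good (Inr i) (Inr j) \<longleftrightarrow> card (B i \<inter> B j) = 1"
    if "i \<in> {1..m}" "j \<in> {1..m}" "i \<noteq> j" for i j
    using that vertex
    by (simp_all add: good_def cocktail_party_edges_def doubleton_mem_matching_edges_iff K)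
  have "(\<forall>u v. {u, v} \<in> ?K \<longrightarrow> good u v) \<longleftrightarrow>
        (\<forall>i\<in>{1..m}. \<forall>j\<in>{1..m}. good (Inl i) (Inr j)) \<and>
        (\<forall>i\<in>{1..m}. \<forall>j\<in>{1..m}. i \<noteq> j \<longrightarrow> good (Inl i) (Inl j)) \<and>
        (\<forall>i\<in>{1..m}. \<forall>j\<in>{1..m}. i \<noteq> j \<longrightarrow> good (Inr i) (Inr j))"
    unfolding K unfolding all_vertices_def left_vertices_def right_vertices_def
    by (auto simp: good_sym)
  moreover have "(\<forall>v\<in>all_vertices m. finite (case_sum A B v) \<and> card (case_sum A B v) \<le> n) \<longleftrightarrow>
      (\<forall>i\<in>{1..m}. finite (A i) \<and> card (A i) \<le> n \<and> finite (B i) \<and> card (B i) \<le> n)"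
    unfolding all_vertices_def left_vertices_def right_vertices_def by (auto simp: ball_Un)
  ultimately show ?thesis
    unfolding one_cross_intersecting_sps_iff[OF assms] intersection_representation_def
      one_intersecting_def good_def[symmetric]
    by (simp add: good_iff good_same)
qed

lemma ex_case_sum_iff: "(\<exists>S. Q S) \<longleftrightarrow> (\<exists>f g. Q (case_sum f g))"
  by (metis surjective_sum)

lemma biclique_sizes_eq: "biclique_sizes n = one_cross_sps_sizes n"
proof -
  have "m \<in> biclique_sizes n \<longleftrightarrow> m \<in> one_cross_sps_sizes n" if m: "m \<ge> 2" for m
  proof -
    let ?L = "left_vertices m" and ?R = "right_vertices m"
    let ?V = "all_vertices m" and ?E = "bipartite_minus_matching_edges m"
    let ?K = "complete_bipartite_edges ?L ?R"
    have E: "?E \<subseteq> ?K" by (auto simp: bipartite_minus_matching_edges_def)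
    have "biclique_partition ?V ?E P \<longleftrightarrow> induced_partition ?V ?K ?E P" for P
      unfolding all_vertices_def using E
      by (intro biclique_partition_iff_induced_partition)
         (auto simp: left_vertices_def right_vertices_def)
    then have "m \<in> biclique_sizes n \<longleftrightarrow>
        (\<exists>P. induced_partition ?V ?K ?E P \<and> thickness ?V P \<le> n)"
      using m by (simp add: biclique_sizes_def)
    also have "\<dots> \<longleftrightarrow> (\<exists>S :: nat + nat \<Rightarrow> nat set. intersection_representation n ?V ?K ?E S)"
      by (rule induced_partition_iff_intersection_representation[OF finite_all_vertices _ E])
         (auto simp: complete_bipartite_edges_def all_vertices_def)
    also have "\<dots> \<longleftrightarrow> m \<in> one_cross_sps_sizes n"
      unfolding ex_case_sum_iff[of "intersection_representation n ?V ?K ?E"]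
        intersection_representation_bipartite_iff[OF m]
      by (simp add: one_cross_sps_sizes_def)
    finally show ?thesis .
  qed
  moreover have "m \<ge> 2" if "m \<in> biclique_sizes n \<or> m \<in> one_cross_sps_sizes n" for m
    using that
    by (auto simp: biclique_sizes_def one_cross_sps_sizes_def cross_intersecting_sps_def)
  ultimately show ?thesis by blast
qed

lemma clique_sizes_eq: "clique_sizes n = one_cross_one_intersecting_sps_sizes n"
proof -
  have "m \<in> clique_sizes n \<longleftrightarrow> m \<in> one_cross_one_intersecting_sps_sizes n" if m: "m \<ge> 2" for m
  proof -
    let ?V = "all_vertices m" and ?E = "cocktail_party_edges m"
    let ?K = "complete_edges ?V"
    have E: "?E \<subseteq> ?K" by (auto simp: cocktail_party_edges_def)
    have "m \<in> clique_sizes n \<longleftrightarrow>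
        (\<exists>P. induced_partition ?V ?K ?E P \<and> thickness ?V P \<le> n)"
      using m by (simp add: clique_sizes_def clique_partition_iff_induced_partition)
    also have "\<dots> \<longleftrightarrow> (\<exists>S :: nat + nat \<Rightarrow> nat set. intersection_representation n ?V ?K ?E S)"
      by (rule induced_partition_iff_intersection_representation[OF finite_all_vertices _ E])
         (auto simp: complete_edges_def)
    also have "\<dots> \<longleftrightarrow> m \<in> one_cross_one_intersecting_sps_sizes n"
      unfolding ex_case_sum_iff[of "intersection_representation n ?V ?K ?E"]
        intersection_representation_complete_iff[OF m]
      by (simp add: one_cross_one_intersecting_sps_sizes_def)
    finally show ?thesis .
  qed
  moreover have "m \<ge> 2" if "m \<in> clique_sizes n \<or> m \<in> one_cross_one_intersecting_sps_sizes n" for m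
    using that
    by (auto simp: clique_sizes_def one_cross_one_intersecting_sps_sizes_def
        cross_intersecting_sps_def)
  ultimately show ?thesis by blast
qed

theorem theorem1p8:
  fixes n :: nat
  assumes "n > 0"
  shows "same_maximum (biclique_sizes n) (one_cross_sps_sizes n) \<and>
         same_maximum (clique_sizes n) (one_cross_one_intersecting_sps_sizes n)"
proof -
  have "one_cross_one_intersecting_sps_sizes n \<subseteq> one_cross_sps_sizes n"
    by (auto simp: one_cross_one_intersecting_sps_sizes_def one_cross_sps_sizes_def)
  then have "finite (one_cross_one_intersecting_sps_sizes n)"
    using finite_one_cross_sps_sizes finite_subset by blast
  then show ?thesis
    by (simp add: same_maximum_def biclique_sizes_eq clique_sizes_eq finite_one_cross_sps_sizes)
qed

end
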